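(* Let $F_\lambda(q)$ be the number of $n\times n$ upper-triangular nilpotent matrices over $\mathbb{F}_q$ of Jordan type $\lambda\vdash n$. If $\lambda=(r,s)\vdash n$ with $r>s\ge1$, then $$F_{(r,s)}(q)=(q-1)^{r+s-2}q^{\binom{r+s-1}{2}-2s+1}\sum_{i=0}^{s}C_{r+s-i,i}\,q^i.$$ If $r=s\geq 1$, then $$F_{(r,r)}(q)=(q-1)^{2r-2}q^{\binom{2r-2}{2}}\sum_{i=0}^{r-1}C_{2r-1-i,i}\,q^i.$$
   Context: Upper-triangular nilpotent matrices are the strictly upper-triangular ones; $q$ is a prime power. A nilpotent $n\times n$ matrix over $\mathbb{F}_q$ has Jordan type $\lambda=(\lambda_1\ge\cdots\ge\lambda_r>0)\vdash n$ if it is similar to $J_{\lambda_1}\oplus\cdots\oplus J_{\lambda_r}$, where $J_i$ is the $i\times i$ Jordan block with eigenvalue $0$. The generalized Catalan numbers are $C_{n,k}=\binom{n+k}{k}-\binom{n+k}{k-1}$ for $n\ge k\ge1$, and $C_{n,0}=1$ for all $n\ge0$. *)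

theory Defs
  imports "Jordan_Normal_Form.Jordan_Normal_Form" "HOL-Library.Cardinality"
begin

definition is_partition :: "nat list \<Rightarrow> nat \<Rightarrow> bool" where
  "is_partition l n \<longleftrightarrow> sorted_wrt (\<ge>) l \<and> (\<forall>k \<in> set l. k > 0) \<and> sum_list l = n"

definition has_jordan_type :: "'a::field mat \<Rightarrow> nat list \<Rightarrow> bool" where
  "has_jordan_type A l \<longleftrightarrow> jordan_nf A (map (\<lambda>k. (k, 0)) l)"

text \<open>Unlike \<open>upper_triangular\<close>, the diagonal entries are required to vanish as well.\<close>

definition strictly_upper_triangular :: "'a::zero mat \<Rightarrow> bool" where
  "strictly_upper_triangular A \<longleftrightarrow> (\<forall>i < dim_row A. \<forall>j \<le> i. A $$ (i, j) = 0)"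

text \<open>The field \<open>F\<^sub>q\<close> is the finite field type \<open>'a\<close>, so \<open>q\<close> is \<open>CARD('a)\<close>.
  The parameter \<open>l\<close> is intended to be a partition of \<open>n\<close>.\<close>

definition F_count :: "'a::{field,finite} itself \<Rightarrow> nat \<Rightarrow> nat list \<Rightarrow> nat" where
  "F_count T n l =
     card {A :: 'a mat. A \<in> carrier_mat n n \<and> strictly_upper_triangular A \<and> has_jordan_type A l}"

text \<open>Meaningful for \<open>k \<le> n\<close> only. The case \<open>k = 0\<close> is separate also because
  \<open>k - 1\<close> is truncated subtraction.\<close>

definition gen_catalan :: "nat \<Rightarrow> nat \<Rightarrow> int" where
  "gen_catalan n k =
     (if k = 0 then 1 else int ((n + k) choose k) - int ((n + k) choose (k - 1)))"

end

theory Submission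
  imports Defs "Jordan_Normal_Form.Jordan_Normal_Form_Existence" "Jordan_Normal_Form.Matrix_Kernel"
begin

text \<open>The Jordan type of a nilpotent matrix is recorded by the sizes of the kernels of its powers.
  Write a strictly upper triangular matrix of size \<open>n + 1\<close> as a strictly upper triangular \<open>A\<close> of
  size \<open>n\<close> with an additional column \<open>v\<close> and a zero row. The kernel of the power \<open>k + 1\<close> then grows
  by a factor \<open>q\<close> exactly if \<open>A\<^sup>k v\<close> lies in the image of \<open>A\<^sup>k\<^sup>+\<^sup>1\<close>, which becomes a weaker condition as
  \<open>k\<close> increases, so that the Young diagram of the Jordan type gains one box. The number of \<open>v\<close> that add
  a box in a given column is determined by the kernel sizes of \<open>A\<close>. For at most two rows this gives
  a recurrence with explicit weights, and after removing powers of \<open>q\<close> and \<open>q - 1\<close> it is the ballot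
  recurrence of the generalized Catalan numbers.\<close>

section \<open>Counting with linear maps over a finite field\<close>

lemma bij_betw_vec_of_list: "bij_betw vec_of_list {xs. length xs = n} (carrier_vec n)"
proof (rule bij_betw_byWitness[where f' = list_of_vec])
  show "vec_of_list ` {xs. length xs = n} \<subseteq> carrier_vec n"
    by (auto intro!: carrier_vecI)
  show "list_of_vec ` carrier_vec n \<subseteq> {xs. length xs = n}" by auto
qed (simp_all add: list_vec vec_list)

lemma finite_carrier_vec [simp]: "finite (carrier_vec n :: 'a::finite vec set)"
  using bij_betw_finite[OF bij_betw_vec_of_list[where 'a = 'a and n = n]]
    finite_lists_length_eq[of "UNIV::'a set" n] by simp

lemma card_carrier_vec: "card (carrier_vec n :: 'a::finite vec set) = CARD('a) ^ n"
  using bij_betw_same_card[OF bij_betw_vec_of_list[where 'a = 'a and n = n]]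
    card_lists_length_eq[of "UNIV::'a set" n] by simp

lemma finite_mat_kernel [simp]: "finite (mat_kernel (A :: 'a::{field,finite} mat))"
  unfolding mat_kernel_def by (rule finite_subset[OF _ finite_carrier_vec[of "dim_col A"]]) auto

lemma card_mult_mat_vec_fibre:
  fixes L :: "'a::{field,finite} mat"
  assumes L: "L \<in> carrier_mat m n" and y: "y \<in> carrier_vec n"
  shows "card {x \<in> carrier_vec n. L *\<^sub>v x = L *\<^sub>v y} = card (mat_kernel L)"
proof -
  have "bij_betw (\<lambda>x. x - y) {x \<in> carrier_vec n. L *\<^sub>v x = L *\<^sub>v y} (mat_kernel L)"
  proof (rule bij_betw_byWitness[where f' = "\<lambda>x. x + y"])
    show "(\<lambda>x. x - y) ` {x \<in> carrier_vec n. L *\<^sub>v x = L *\<^sub>v y} \<subseteq> mat_kernel L"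
      using y L by (auto simp: mat_kernel[OF L] mult_minus_distrib_mat_vec[OF L])
    show "(\<lambda>x. x + y) ` mat_kernel L \<subseteq> {x \<in> carrier_vec n. L *\<^sub>v x = L *\<^sub>v y}"
      using y L by (auto simp: mat_kernel[OF L] mult_add_distrib_mat_vec[OF L])
  qed (use y L in \<open>auto simp: mat_kernel[OF L]\<close>)
  then show ?thesis by (rule bij_betw_same_card)
qed

text \<open>The hypothesis on \<open>W\<close> makes the fibre over each point of \<open>W\<close>
  nonempty, hence a translate of the kernel. The fibres are disjoint, so their sizes add up.\<close>

lemma card_mult_mat_vec_vimage:
  fixes L :: "'a::{field,finite} mat"
  assumes L: "L \<in> carrier_mat m n" and W: "W \<subseteq> (*\<^sub>v) L ` carrier_vec n"
  shows "card {x \<in> carrier_vec n. L *\<^sub>v x \<in> W} = card W * card (mat_kernel L)"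
proof -
  have fin: "finite W" using W by (rule finite_subset) simp
  have "{x \<in> carrier_vec n. L *\<^sub>v x \<in> W} = (\<Union>w\<in>W. {x \<in> carrier_vec n. L *\<^sub>v x = w})" by auto
  then have "card {x \<in> carrier_vec n. L *\<^sub>v x \<in> W} = (\<Sum>w\<in>W. card {x \<in> carrier_vec n. L *\<^sub>v x = w})"
    using fin by (simp add: card_UN_disjoint disjoint_iff)
  also have "\<dots> = (\<Sum>w\<in>W. card (mat_kernel L))"
  proof (rule sum.cong)
    fix w assume "w \<in> W"
    then obtain y where "y \<in> carrier_vec n" "w = L *\<^sub>v y" using W by auto
    then show "card {x \<in> carrier_vec n. L *\<^sub>v x = w} = card (mat_kernel L)"
      using card_mult_mat_vec_fibre[OF L] by simp
  qed simp
  finally show ?thesis by simp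
qed

text \<open>Rank-nullity in multiplicative form. Counting elements instead of dimensions is all that
  is required over a finite field.\<close>

lemma card_range_mult_card_kernel:
  fixes L :: "'a::{field,finite} mat"
  assumes L: "L \<in> carrier_mat m n"
  shows "card ((*\<^sub>v) L ` carrier_vec n) * card (mat_kernel L) = CARD('a) ^ n"
proof -
  have "{x \<in> carrier_vec n. L *\<^sub>v x \<in> (*\<^sub>v) L ` carrier_vec n} = carrier_vec n" by auto
  then show ?thesis using card_mult_mat_vec_vimage[OF L order_refl] by (simp add: card_carrier_vec)
qed

text \<open>From A = P B Q with mutually inverse P and Q follow the intertwining relations
  \<open>BQ\<close> and \<open>AP\<close>, so Q carries ker A onto ker B with inverse P.\<close>

lemma card_mat_kernel_similar:
  fixes A :: "'a::{field,finite} mat"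
  assumes "similar_mat A B"
  shows "card (mat_kernel A) = card (mat_kernel B)"
proof -
  obtain P Q where wit: "similar_mat_wit A B P Q" using assms unfolding similar_mat_def by auto
  define n where "n = dim_row A"
  note w = similar_mat_witD[OF n_def wit]
  have BQ: "B * Q = Q * A"
  proof -
    have "Q * A = (Q * P) * (B * Q)"
      unfolding w(3) using w(5-7) by (simp add: assoc_mult_mat[of _ n n _ n _ n])
    then show ?thesis unfolding w(2) using w(5,7) by simp
  qed
  have AP: "A * P = P * B"
  proof -
    have "A * P = P * B * (Q * P)"
      unfolding w(3) using w(5-7) by (simp add: assoc_mult_mat[of _ n n _ n _ n])
    then show ?thesis unfolding w(2) using w(5,6) by simp
  qed
  have QP: "Q *\<^sub>v (P *\<^sub>v x) = x" and PQ: "P *\<^sub>v (Q *\<^sub>v x) = x" if "x \<in> carrier_vec n" for x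
    using that w(1,2,6,7) assoc_mult_mat_vec[of Q n n P n x] assoc_mult_mat_vec[of P n n Q n x] by auto
  have "bij_betw ((*\<^sub>v) Q) (mat_kernel A) (mat_kernel B)"
  proof (rule bij_betw_byWitness[where f' = "(*\<^sub>v) P"])
    show "\<forall>a\<in>mat_kernel A. P *\<^sub>v (Q *\<^sub>v a) = a"
      by (simp add: mat_kernel[OF w(4)] PQ)
    show "\<forall>a\<in>mat_kernel B. Q *\<^sub>v (P *\<^sub>v a) = a"
      by (simp add: mat_kernel[OF w(5)] QP)
    show "(*\<^sub>v) Q ` mat_kernel A \<subseteq> mat_kernel B"
    proof
      fix y assume "y \<in> (*\<^sub>v) Q ` mat_kernel A"
      then obtain x where x: "x \<in> carrier_vec n" "A *\<^sub>v x = 0\<^sub>v n" "y = Q *\<^sub>v x"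
        by (auto simp: mat_kernel[OF w(4)])
      have "B *\<^sub>v y = (B * Q) *\<^sub>v x" using w(5,7) x by simp
      also have "\<dots> = Q *\<^sub>v (A *\<^sub>v x)" unfolding BQ using w(4,7) x(1) by simp
      also have "\<dots> = 0\<^sub>v n" unfolding x(2) using w(7) by auto
      finally show "y \<in> mat_kernel B" using w(7) x by (simp add: mat_kernel[OF w(5)])
    qed
    show "(*\<^sub>v) P ` mat_kernel B \<subseteq> mat_kernel A"
    proof
      fix y assume "y \<in> (*\<^sub>v) P ` mat_kernel B"
      then obtain x where x: "x \<in> carrier_vec n" "B *\<^sub>v x = 0\<^sub>v n" "y = P *\<^sub>v x"
        by (auto simp: mat_kernel[OF w(5)])
      have "A *\<^sub>v y = (A * P) *\<^sub>v x" using w(4,6) x by simp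
      also have "\<dots> = P *\<^sub>v (B *\<^sub>v x)" unfolding AP using w(5,6) x(1) by simp
      also have "\<dots> = 0\<^sub>v n" unfolding x(2) using w(6) by auto
      finally show "y \<in> mat_kernel A" using w(6) x by (simp add: mat_kernel[OF w(4)])
    qed
  qed
  then show ?thesis by (rule bij_betw_same_card)
qed

lemma card_mat_kernel_block_diag:
  fixes A :: "'a::{field,finite} mat"
  assumes A: "A \<in> carrier_mat n n" and D: "D \<in> carrier_mat m m"
  shows "card (mat_kernel (four_block_mat A (0\<^sub>m n m) (0\<^sub>m m n) D)) = card (mat_kernel A) * card (mat_kernel D)"
proof -
  let ?M = "four_block_mat A (0\<^sub>m n m) (0\<^sub>m m n) D"
  have M: "?M \<in> carrier_mat (n + m) (n + m)" using A D by simp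
  have zero: "0\<^sub>v (n + m) = 0\<^sub>v n @\<^sub>v 0\<^sub>v m" by auto
  have "bij_betw (\<lambda>(a, d). a @\<^sub>v d) (mat_kernel A \<times> mat_kernel D) (mat_kernel ?M)"
    unfolding bij_betw_def
  proof
    show "inj_on (\<lambda>(a, d). a @\<^sub>v d) (mat_kernel A \<times> mat_kernel D)"
      by (auto simp: inj_on_def mat_kernel[OF A])
    show "(\<lambda>(a, d). a @\<^sub>v d) ` (mat_kernel A \<times> mat_kernel D) = mat_kernel ?M"
    proof
      show "(\<lambda>(a, d). a @\<^sub>v d) ` (mat_kernel A \<times> mat_kernel D) \<subseteq> mat_kernel ?M"
        by (auto simp: mat_kernel[OF A] mat_kernel[OF D] mat_kernel[OF M] mult_mat_vec_split[OF A D])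
      show "mat_kernel ?M \<subseteq> (\<lambda>(a, d). a @\<^sub>v d) ` (mat_kernel A \<times> mat_kernel D)"
      proof
        fix x assume x: "x \<in> mat_kernel ?M"
        then have xc: "x \<in> carrier_vec (n + m)" by (simp add: mat_kernel[OF M])
        let ?a = "vec_first x n" and ?d = "vec_last x m"
        have eq: "x = ?a @\<^sub>v ?d" using xc by simp
        have a: "?a \<in> carrier_vec n" and d: "?d \<in> carrier_vec m" by simp_all
        have "A *\<^sub>v ?a @\<^sub>v D *\<^sub>v ?d = 0\<^sub>v n @\<^sub>v 0\<^sub>v m"
          using x mult_mat_vec_split[OF A D a d] xc unfolding zero[symmetric] by (simp add: mat_kernel[OF M])
        then have "A *\<^sub>v ?a = 0\<^sub>v n \<and> D *\<^sub>v ?d = 0\<^sub>v m"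
          using A a by (subst (asm) append_vec_eq[of _ n]) auto
        then have "(?a, ?d) \<in> mat_kernel A \<times> mat_kernel D"
          using a d by (simp add: mat_kernel[OF A] mat_kernel[OF D])
        then show "x \<in> (\<lambda>(a, d). a @\<^sub>v d) ` (mat_kernel A \<times> mat_kernel D)"
          using eq by (metis (no_types, lifting) case_prod_conv image_eqI)
      qed
    qed
  qed
  then have "card (mat_kernel A \<times> mat_kernel D) = card (mat_kernel ?M)" by (rule bij_betw_same_card)
  then show ?thesis by (simp add: card_cartesian_product)
qed

section \<open>Kernels of powers of a bordered matrix\<close>

abbreviation nker :: "'a::{field,finite} mat \<Rightarrow> nat \<Rightarrow> nat" where
  "nker A k \<equiv> card (mat_kernel (A ^\<^sub>m k))"

lemma nker_0: "A \<in> carrier_mat n n \<Longrightarrow> nker A 0 = 1"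
proof -
  assume "A \<in> carrier_mat n n"
  then have "mat_kernel (A ^\<^sub>m 0) = {0\<^sub>v n}" by (auto simp: mat_kernel_def)
  then show ?thesis by simp
qed

lemma nker_pos: "A \<in> carrier_mat n n \<Longrightarrow> nker A k > 0"
proof -
  assume A: "A \<in> carrier_mat n n"
  then have "0\<^sub>v n \<in> mat_kernel (A ^\<^sub>m k)" by (intro mat_kernelI[of _ n n]) auto
  then show ?thesis by (auto simp: card_gt_0_iff)
qed

definition bordered_mat :: "'a::field mat \<Rightarrow> 'a vec \<Rightarrow> 'a mat" where
  "bordered_mat A v =
     four_block_mat A (mat_of_cols (dim_row A) [v]) (0\<^sub>m 1 (dim_col A)) (0\<^sub>m 1 1)"

lemma bordered_mat_carrier:
  "A \<in> carrier_mat n n \<Longrightarrow> bordered_mat A v \<in> carrier_mat (Suc n) (Suc n)"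
  unfolding bordered_mat_def by auto

lemma bordered_mat_index:
  assumes "A \<in> carrier_mat n n" "v \<in> carrier_vec n" "i < Suc n" "j < Suc n"
  shows "bordered_mat A v $$ (i, j) =
    (if i < n then if j < n then A $$ (i, j) else v $ i else 0)"
  using assms unfolding bordered_mat_def by (auto simp: mat_of_cols_def)

lemma bordered_mat_mult_vec:
  assumes A: "A \<in> carrier_mat n n" and v: "v \<in> carrier_vec n" and x: "x \<in> carrier_vec n"
  shows "bordered_mat A v *\<^sub>v (x @\<^sub>v vec 1 (\<lambda>_. c)) =
    (A *\<^sub>v x + c \<cdot>\<^sub>v v) @\<^sub>v vec 1 (\<lambda>_. 0)"
proof -
  have "mat_of_cols n [v] *\<^sub>v vec 1 (\<lambda>_. c) = c \<cdot>\<^sub>v v"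
    using v by (intro eq_vecI) (auto simp: scalar_prod_def mat_of_cols_def)
  moreover have "(0\<^sub>m 1 n :: 'a mat) *\<^sub>v x + 0\<^sub>m 1 1 *\<^sub>v vec 1 (\<lambda>_. c) = vec 1 (\<lambda>_. 0)"
    using x by (intro eq_vecI) (auto simp: scalar_prod_def)
  moreover have "bordered_mat A v *\<^sub>v (x @\<^sub>v vec 1 (\<lambda>_. c)) =
     (A *\<^sub>v x + mat_of_cols n [v] *\<^sub>v vec 1 (\<lambda>_. c)) @\<^sub>v
     ((0\<^sub>m 1 n :: 'a mat) *\<^sub>v x + 0\<^sub>m 1 1 *\<^sub>v vec 1 (\<lambda>_. c))"
    unfolding bordered_mat_def using A x
    by (subst four_block_mat_mult_vec[of _ n n _ 1 _ 1]) auto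
  ultimately show ?thesis by simp
qed

text \<open>One application of the bordered matrix sets the last coordinate to 0. The column
  \<open>v\<close> therefore enters only once, with factor \<open>c\<close>, and is afterwards moved
  by the remaining k factors A.\<close>

lemma bordered_mat_pow_mult_vec:
  assumes A: "A \<in> carrier_mat n n" and v: "v \<in> carrier_vec n" and x: "x \<in> carrier_vec n"
  shows "(bordered_mat A v ^\<^sub>m Suc k) *\<^sub>v (x @\<^sub>v vec 1 (\<lambda>_. c)) =
    ((A ^\<^sub>m Suc k) *\<^sub>v x + c \<cdot>\<^sub>v ((A ^\<^sub>m k) *\<^sub>v v)) @\<^sub>v vec 1 (\<lambda>_. 0)"
  using x
proof (induction k arbitrary: x c)
  case 0
  then show ?case using A v bordered_mat_carrier[OF A, of v] bordered_mat_mult_vec[OF A v, of x c]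
    by simp
next
  case (Suc k)
  have B: "bordered_mat A v ^\<^sub>m m \<in> carrier_mat (Suc n) (Suc n)" for m
    using bordered_mat_carrier[OF A] by simp
  have Ak: "A ^\<^sub>m m \<in> carrier_mat n n" for m using A by simp
  have y: "A *\<^sub>v x + c \<cdot>\<^sub>v v \<in> carrier_vec n" using A v Suc.prems by auto
  have "(bordered_mat A v ^\<^sub>m Suc (Suc k)) *\<^sub>v (x @\<^sub>v vec 1 (\<lambda>_. c)) =
    (bordered_mat A v ^\<^sub>m Suc k) *\<^sub>v (bordered_mat A v *\<^sub>v (x @\<^sub>v vec 1 (\<lambda>_. c)))"
    unfolding pow_mat.simps(2)[of _ "Suc k"]
    using B[of "Suc k"] bordered_mat_carrier[OF A, of v] append_carrier_vec[OF Suc.prems, of "vec 1 (\<lambda>_. c)" 1]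
    by (intro assoc_mult_mat_vec[of _ "Suc n" "Suc n" _ "Suc n"]) auto
  \<comment> \<open>The induction hypothesis is used with last coordinate 0 and the new vector A x +
    c v, so both \<open>x\<close> and \<open>c\<close> have to be arbitrary in the
    induction.\<close>
  also have "\<dots> = ((A ^\<^sub>m Suc k) *\<^sub>v (A *\<^sub>v x + c \<cdot>\<^sub>v v) + 0 \<cdot>\<^sub>v ((A ^\<^sub>m k) *\<^sub>v v)) @\<^sub>v vec 1 (\<lambda>_. 0)"
    unfolding bordered_mat_mult_vec[OF A v Suc.prems] by (rule Suc.IH[OF y])
  also have "(A ^\<^sub>m Suc k) *\<^sub>v (A *\<^sub>v x + c \<cdot>\<^sub>v v) + 0 \<cdot>\<^sub>v ((A ^\<^sub>m k) *\<^sub>v v) =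
      (A ^\<^sub>m Suc (Suc k)) *\<^sub>v x + c \<cdot>\<^sub>v ((A ^\<^sub>m Suc k) *\<^sub>v v)"
  proof -
    have "0 \<cdot>\<^sub>v ((A ^\<^sub>m k) *\<^sub>v v) = 0\<^sub>v n" using Ak[of k] v by (intro eq_vecI) auto
    moreover have "(A ^\<^sub>m Suc k) *\<^sub>v (A *\<^sub>v x + c \<cdot>\<^sub>v v) =
        (A ^\<^sub>m Suc k) *\<^sub>v (A *\<^sub>v x) + (A ^\<^sub>m Suc k) *\<^sub>v (c \<cdot>\<^sub>v v)"
      using A v Suc.prems Ak[of "Suc k"] by (intro mult_add_distrib_mat_vec[of _ n n]) auto
    moreover have "(A ^\<^sub>m Suc k) *\<^sub>v (c \<cdot>\<^sub>v v) = c \<cdot>\<^sub>v ((A ^\<^sub>m Suc k) *\<^sub>v v)"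
      using Ak[of "Suc k"] v by (rule mult_mat_vec)
    moreover have "(A ^\<^sub>m Suc k) *\<^sub>v (A *\<^sub>v x) = (A ^\<^sub>m Suc (Suc k)) *\<^sub>v x"
      unfolding pow_mat.simps(2)[of _ "Suc k"]
      using A Suc.prems Ak[of "Suc k"] by (intro assoc_mult_mat_vec[symmetric, of _ n n _ n]) auto
    moreover have "(A ^\<^sub>m Suc (Suc k)) *\<^sub>v x \<in> carrier_vec n" "(A ^\<^sub>m Suc k) *\<^sub>v v \<in> carrier_vec n"
      using Ak[of "Suc (Suc k)"] Ak[of "Suc k"] v Suc.prems by (auto simp del: pow_mat.simps)
    ultimately show ?thesis by (simp del: pow_mat.simps)
  qed
  finally show ?case .
qed

section \<open>Growth spaces and the kernels of a bordered matrix\<close>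

text \<open>Equivalently, \<open>growth_space A k\<close> is the sum of the image of \<open>A\<close> and the kernel of \<open>A\<close> to the
  power \<open>k\<close>.\<close>

definition growth_space :: "'a::field mat \<Rightarrow> nat \<Rightarrow> 'a vec set" where
  "growth_space A k = {v \<in> carrier_vec (dim_row A).
     (A ^\<^sub>m k) *\<^sub>v v \<in> (*\<^sub>v) (A ^\<^sub>m Suc k) ` carrier_vec (dim_row A)}"

text \<open>A witness x with A^k v = A^(k+1) x stays a witness after multiplication by A from the
  left.\<close>

lemma growth_space_mono:
  assumes A: "A \<in> carrier_mat n n" and "i \<le> j"
  shows "growth_space A i \<subseteq> growth_space A j"
proof -
  have "growth_space A k \<subseteq> growth_space A (Suc k)" for k
  proof
    fix v assume "v \<in> growth_space A k"
    then obtain x where v: "v \<in> carrier_vec n" and x: "x \<in> carrier_vec n"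
      and eq: "(A ^\<^sub>m k) *\<^sub>v v = (A ^\<^sub>m Suc k) *\<^sub>v x"
      using A by (auto simp: growth_space_def simp del: pow_mat.simps)
    \<comment> \<open>\<open>pow_mat\<close> puts the new factor on the right, whereas here it is
      needed on the left.\<close>
    have "A ^\<^sub>m Suc m = A * A ^\<^sub>m m" for m
    proof (induction m)
      case (Suc m)
      have "A ^\<^sub>m Suc (Suc m) = A * A ^\<^sub>m m * A" using Suc.IH by simp
      then show ?case using A assoc_mult_mat[of A n n "A ^\<^sub>m m" n A n] by simp
    qed (use A in simp)
    then have *: "(A ^\<^sub>m Suc m) *\<^sub>v z = A *\<^sub>v ((A ^\<^sub>m m) *\<^sub>v z)" if "z \<in> carrier_vec n" for m z
      using A that assoc_mult_mat_vec[of A n n "A ^\<^sub>m m" n z] by simp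
    have "(A ^\<^sub>m Suc k) *\<^sub>v v = (A ^\<^sub>m Suc (Suc k)) *\<^sub>v x"
      using *[OF v, of k] *[OF x, of "Suc k"] eq by simp
    then show "v \<in> growth_space A (Suc k)"
      using v x A by (auto simp: growth_space_def simp del: pow_mat.simps)
  qed
  then show ?thesis using assms(2) by (rule lift_Suc_mono_le)
qed

text \<open>The growth space is the preimage under A^k of im A^(k+1), a subset of im A^k, so its
  size is |im A^(k+1)| |ker A^k|. Rank-nullity for A^(k+1) eliminates the image; the product form
  avoids division. In dimensions, the codimension of the growth space is the length of column k + 1
  of the Young diagram.\<close>

lemma card_growth_space:
  fixes A :: "'a::{field,finite} mat"
  assumes A: "A \<in> carrier_mat n n"
  shows "card (growth_space A k) * nker A (Suc k) = CARD('a) ^ n * nker A k"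
proof -
  have Ak: "A ^\<^sub>m k \<in> carrier_mat n n" for k using A by simp
  have dim: "dim_row A = n" using A by simp
  have sub: "(*\<^sub>v) (A ^\<^sub>m Suc k) ` carrier_vec n \<subseteq> (*\<^sub>v) (A ^\<^sub>m k) ` carrier_vec n"
  proof
    fix y assume "y \<in> (*\<^sub>v) (A ^\<^sub>m Suc k) ` carrier_vec n"
    then obtain x where "x \<in> carrier_vec n" "y = (A ^\<^sub>m Suc k) *\<^sub>v x" by auto
    then have "y = (A ^\<^sub>m k) *\<^sub>v (A *\<^sub>v x)" "A *\<^sub>v x \<in> carrier_vec n"
      using A Ak[of k] assoc_mult_mat_vec[of "A ^\<^sub>m k" n n A n x] by auto
    then show "y \<in> (*\<^sub>v) (A ^\<^sub>m k) ` carrier_vec n" by auto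
  qed
  have "card (growth_space A k) = card ((*\<^sub>v) (A ^\<^sub>m Suc k) ` carrier_vec n) * nker A k"
    unfolding growth_space_def dim by (rule card_mult_mat_vec_vimage[OF Ak sub])
  then show ?thesis
    using card_range_mult_card_kernel[OF Ak, of "Suc k"] by (simp add: ac_simps del: pow_mat.simps)
qed

text \<open>Growth spaces increase with k, so their codimensions, the increments of dim ker A^k,
  decrease: the columns of a Young diagram do not get longer to the right.\<close>

lemma nker_log_concave:
  fixes A :: "'a::{field,finite} mat"
  assumes A: "A \<in> carrier_mat n n"
  shows "nker A k * nker A (Suc (Suc k)) \<le> nker A (Suc k) ^ 2"
proof -
  let ?q = "CARD('a) ^ n"
  have "finite (growth_space A (Suc k))"
    unfolding growth_space_def by (rule finite_subset[OF _ finite_carrier_vec[of "dim_row A"]]) auto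
  then have le: "card (growth_space A k) \<le> card (growth_space A (Suc k))"
    using growth_space_mono[OF A, of k "Suc k"] by (simp add: card_mono)
  have "?q * (nker A k * nker A (Suc (Suc k))) =
      card (growth_space A k) * nker A (Suc k) * nker A (Suc (Suc k))"
    using card_growth_space[OF A, of k] by (simp add: ac_simps del: pow_mat.simps)
  also have "\<dots> \<le> card (growth_space A (Suc k)) * nker A (Suc k) * nker A (Suc (Suc k))"
    using le by (intro mult_right_mono) auto
  also have "\<dots> = ?q * nker A (Suc k) ^ 2"
    using card_growth_space[OF A, of "Suc k"]
    by (simp add: ac_simps power2_eq_square del: pow_mat.simps)
  finally show ?thesis by (simp del: pow_mat.simps)
qed

text \<open>The kernel of the bordered power is sliced by the last coordinate. A slice solves
  A^(k+1) x = c A^k v, so it is empty or a coset of ker A^(k+1). If \<open>v\<close> is in the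
  growth space all q slices are cosets, otherwise only the slice c = 0 is nonempty.\<close>

lemma nker_bordered_mat:
  fixes A :: "'a::{field,finite} mat"
  assumes A: "A \<in> carrier_mat n n" and v: "v \<in> carrier_vec n"
  shows "nker (bordered_mat A v) (Suc k) =
    (if v \<in> growth_space A k then CARD('a) else 1) * nker A (Suc k)"
proof -
  let ?L = "A ^\<^sub>m Suc k" and ?w = "(A ^\<^sub>m k) *\<^sub>v v" and ?B = "bordered_mat A v ^\<^sub>m Suc k"
  \<comment> \<open>\<open>S c\<close> is the slice over last coordinate -c; the sign moves the term
    with \<open>v\<close> to the right-hand side.\<close>
  define S where "S c = {x \<in> carrier_vec n. ?L *\<^sub>v x = c \<cdot>\<^sub>v ?w}" for c
  have L: "?L \<in> carrier_mat n n" using A by auto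
  have w: "?w \<in> carrier_vec n" by (rule mult_mat_vec_carrier[OF pow_carrier_mat[OF A] v])
  have B: "?B \<in> carrier_mat (Suc n) (Suc n)" by (rule pow_carrier_mat[OF bordered_mat_carrier[OF A]])
  have B_mult: "?B *\<^sub>v (x @\<^sub>v vec 1 (\<lambda>_. c)) = (?L *\<^sub>v x + c \<cdot>\<^sub>v ?w) @\<^sub>v vec 1 (\<lambda>_. 0)"
    if "x \<in> carrier_vec n" for x c
    by (rule bordered_mat_pow_mult_vec[OF A v that])
  have zero: "0\<^sub>v (Suc n) = 0\<^sub>v n @\<^sub>v vec 1 (\<lambda>_. 0 :: 'a)" by auto
  have ker_iff: "x @\<^sub>v vec 1 (\<lambda>_. c) \<in> mat_kernel ?B \<longleftrightarrow> x \<in> S (- c)" if x: "x \<in> carrier_vec n" for x c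
  proof -
    have "x @\<^sub>v vec 1 (\<lambda>_. c) \<in> mat_kernel ?B \<longleftrightarrow> ?L *\<^sub>v x + c \<cdot>\<^sub>v ?w = 0\<^sub>v n"
      using x w L append_carrier_vec[OF x, of "vec 1 (\<lambda>_. c)" 1]
      unfolding mat_kernel[OF B] mem_Collect_eq B_mult[OF x] zero
      by (subst append_vec_eq[of _ n]) (auto simp del: pow_mat.simps)
    also have "\<dots> \<longleftrightarrow> ?L *\<^sub>v x = (- c) \<cdot>\<^sub>v ?w"
    proof -
      have "(?L *\<^sub>v x + c \<cdot>\<^sub>v ?w = 0\<^sub>v n) = (\<forall>i<n. (?L *\<^sub>v x) $ i + c * ?w $ i = 0)"
        using w L by (auto simp: vec_eq_iff simp del: pow_mat.simps index_mult_mat_vec)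
      moreover have "(?L *\<^sub>v x = (- c) \<cdot>\<^sub>v ?w) = (\<forall>i<n. (?L *\<^sub>v x) $ i = - c * ?w $ i)"
        using w L by (auto simp: vec_eq_iff simp del: pow_mat.simps index_mult_mat_vec)
      ultimately show ?thesis by (simp add: eq_neg_iff_add_eq_0 del: pow_mat.simps)
    qed
    finally show ?thesis using x by (simp add: S_def del: pow_mat.simps)
  qed
  have "bij_betw (\<lambda>(c, x). x @\<^sub>v vec 1 (\<lambda>_. - c)) (SIGMA c:UNIV. S c) (mat_kernel ?B)"
    unfolding bij_betw_def
  proof
    show "inj_on (\<lambda>(c, x). x @\<^sub>v vec 1 (\<lambda>_. - c)) (SIGMA c:UNIV. S c)"
    proof (clarsimp simp: inj_on_def simp del: pow_mat.simps)
      fix c x d y assume *: "x \<in> S c" "y \<in> S d" "x @\<^sub>v vec (Suc 0) (\<lambda>_. - c) = y @\<^sub>v vec (Suc 0) (\<lambda>_. - d)"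
      then have "x \<in> carrier_vec n" "y \<in> carrier_vec n" by (auto simp: S_def)
      then have "x = y \<and> vec (Suc 0) (\<lambda>_. - c) = vec (Suc 0) (\<lambda>_. - d)"
        using *(3) by (subst (asm) append_vec_eq) auto
      then show "c = d \<and> x = y" by (auto simp: vec_eq_iff)
    qed
    show "(\<lambda>(c, x). x @\<^sub>v vec 1 (\<lambda>_. - c)) ` (SIGMA c:UNIV. S c) = mat_kernel ?B"
    proof
      show "(\<lambda>(c, x). x @\<^sub>v vec 1 (\<lambda>_. - c)) ` (SIGMA c:UNIV. S c) \<subseteq> mat_kernel ?B"
        using ker_iff by (auto simp: S_def simp del: pow_mat.simps)
      show "mat_kernel ?B \<subseteq> (\<lambda>(c, x). x @\<^sub>v vec 1 (\<lambda>_. - c)) ` (SIGMA c:UNIV. S c)"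
      proof
        fix z assume z: "z \<in> mat_kernel ?B"
        then have "z \<in> carrier_vec (Suc n)" using mat_kernelD[OF B] by blast
        then have eq: "z = vec_first z n @\<^sub>v vec 1 (\<lambda>_. - (- z $ n))"
          by (intro eq_vecI) (auto simp: vec_first_def less_Suc_eq)
        then have "vec_first z n \<in> S (- z $ n)"
          using z ker_iff[of "vec_first z n" "- (- z $ n)"] by (simp del: pow_mat.simps)
        then show "z \<in> (\<lambda>(c, x). x @\<^sub>v vec 1 (\<lambda>_. - c)) ` (SIGMA c:UNIV. S c)"
          by (intro image_eqI[of _ _ "(- z $ n, vec_first z n)"]) (use eq in auto)
      qed
    qed
  qed
  then have "card (mat_kernel ?B) = card (SIGMA c:UNIV. S c)" by (rule bij_betw_same_card[symmetric])
  also have "\<dots> = (\<Sum>c\<in>UNIV. card (S c))"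
    by (rule card_SigmaI) (auto simp: S_def)
  also have "\<dots> = (if v \<in> growth_space A k then CARD('a) else 1) * nker A (Suc k)"
  proof (cases "v \<in> growth_space A k")
    case True
    then obtain y where y: "y \<in> carrier_vec n" "?w = ?L *\<^sub>v y"
      using A by (auto simp: growth_space_def simp del: pow_mat.simps)
    have "card (S c) = nker A (Suc k)" for c
    proof -
      have "c \<cdot>\<^sub>v ?w = ?L *\<^sub>v (c \<cdot>\<^sub>v y)" unfolding y(2) using L y(1) by (rule mult_mat_vec[symmetric])
      then show ?thesis
        using card_mult_mat_vec_fibre[OF L, of "c \<cdot>\<^sub>v y"] y(1) by (simp add: S_def del: pow_mat.simps)
    qed
    then show ?thesis using True by (simp del: pow_mat.simps)
  next
    case False
    \<comment> \<open>Scaling a solution for some nonzero c by its inverse would put A^k v into the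
      image of A^(k+1).\<close>
    have "S c = {}" if "c \<noteq> 0" for c
    proof (rule ccontr)
      assume "S c \<noteq> {}"
      then obtain x where x: "x \<in> carrier_vec n" "?L *\<^sub>v x = c \<cdot>\<^sub>v ?w" by (auto simp: S_def)
      have "?L *\<^sub>v (inverse c \<cdot>\<^sub>v x) = inverse c \<cdot>\<^sub>v (c \<cdot>\<^sub>v ?w)"
        using mult_mat_vec[OF L x(1)] x(2) by simp
      also have "\<dots> = ?w" using that by (simp add: smult_smult_assoc)
      finally have "?w \<in> (*\<^sub>v) ?L ` carrier_vec n" using x(1)
        by (metis image_eqI smult_carrier_vec)
      then show False using False A v by (simp add: growth_space_def)
    qed
    then have "(\<Sum>c\<in>UNIV. card (S c)) = (\<Sum>c\<in>{0}. card (S c))"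
      by (intro sum.mono_neutral_right) auto
    moreover have "S 0 = mat_kernel ?L"
    proof -
      have "0 \<cdot>\<^sub>v ?w = 0\<^sub>v n" using w A by (intro eq_vecI) auto
      then show ?thesis by (simp add: S_def mat_kernel[OF L] del: pow_mat.simps)
    qed
    ultimately show ?thesis using False by (simp del: pow_mat.simps)
  qed
  finally show ?thesis .
qed

section \<open>Jordan type and kernel sizes\<close>

text \<open>The power k of the block shifts coordinates by k, so its kernel consists of the vectors
  supported on the first min k n coordinates.\<close>

lemma nker_jordan_block:
  "nker (jordan_block n (0 :: 'a::{field,finite})) k = CARD('a) ^ min k n"
proof -
  let ?J = "jordan_block n (0 :: 'a) ^\<^sub>m k"
  have J: "?J \<in> carrier_mat n n" by simp
  have idx: "(?J *\<^sub>v x) $ i = (if i + k < n then x $ (i + k) else 0)"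
    if x: "x \<in> carrier_vec n" and i: "i < n" for x i
  proof -
    have "(?J *\<^sub>v x) $ i = (\<Sum>j = 0..<n. (if j = i + k then 1 else 0) * x $ j)"
      using x i by (auto simp: jordan_block_zero_pow scalar_prod_def intro!: sum.cong)
    also have "\<dots> = (\<Sum>j = 0..<n. if j = i + k then x $ j else 0)"
      by (intro sum.cong) auto
    finally show ?thesis by (simp add: sum.delta)
  qed
  have kernel_iff: "x \<in> mat_kernel ?J \<longleftrightarrow> (\<forall>j. k \<le> j \<and> j < n \<longrightarrow> x $ j = 0)"
    if x: "x \<in> carrier_vec n" for x
  proof -
    have "x \<in> mat_kernel ?J \<longleftrightarrow> (\<forall>i<n. (?J *\<^sub>v x) $ i = 0)"
      using x by (auto simp: mat_kernel[OF J] vec_eq_iff simp del: index_mult_mat_vec)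
    also have "\<dots> \<longleftrightarrow> (\<forall>i. i + k < n \<longrightarrow> x $ (i + k) = 0)"
      using x by (auto simp: idx simp del: index_mult_mat_vec)
    also have "\<dots> \<longleftrightarrow> (\<forall>j. k \<le> j \<and> j < n \<longrightarrow> x $ j = 0)"
      by (metis add.commute le_Suc_ex le_add2)
    finally show ?thesis .
  qed
  let ?m = "min k n"
  have "bij_betw (\<lambda>x. vec_first x ?m) (mat_kernel ?J) (carrier_vec ?m)"
  proof (rule bij_betw_byWitness[where f' = "\<lambda>y. vec n (\<lambda>i. if i < ?m then y $ i else 0)"])
    show "\<forall>x\<in>mat_kernel ?J. vec n (\<lambda>i. if i < ?m then vec_first x ?m $ i else 0) = x"
    proof
      fix x assume "x \<in> mat_kernel ?J"
      then show "vec n (\<lambda>i. if i < ?m then vec_first x ?m $ i else 0) = x"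
        using kernel_iff[of x] mat_kernelD(1)[OF J, of x]
        by (intro eq_vecI) (auto simp: vec_first_def)
    qed
    show "\<forall>y\<in>carrier_vec ?m. vec_first (vec n (\<lambda>i. if i < ?m then y $ i else 0)) ?m = y"
      by (auto simp: vec_first_def vec_eq_iff)
    show "(\<lambda>y. vec n (\<lambda>i. if i < ?m then y $ i else 0)) ` carrier_vec ?m \<subseteq> mat_kernel ?J"
      by (auto simp: kernel_iff)
  qed (auto simp: vec_first_def)
  then show ?thesis by (simp add: bij_betw_same_card card_carrier_vec)
qed

lemma nker_jordan_matrix:
  "nker (jordan_matrix (map (\<lambda>m. (m, 0 :: 'a::{field,finite})) l)) k =
    CARD('a) ^ (\<Sum>m\<leftarrow>l. min k m)"
proof (induction l)
  case Nil
  \<comment> \<open>The empty direct sum equals the block of size 0, which the formula for single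
    blocks covers.\<close>
  have "nker (jordan_matrix [] :: 'a mat) k = nker (jordan_block 0 (0 :: 'a)) k"
    by (rule arg_cong[where f = "\<lambda>A. nker A k"]) (auto simp: jordan_matrix_def)
  then show ?case unfolding nker_jordan_block by simp
next
  case (Cons m l)
  let ?D = "jordan_matrix (map (\<lambda>m. (m, 0 :: 'a)) l)"
  let ?s = "sum_list l"
  have D: "?D \<in> carrier_mat ?s ?s"
    using jordan_matrix_carrier[of "map (\<lambda>m. (m, 0 :: 'a)) l"] by (simp add: comp_def)
  have "jordan_matrix (map (\<lambda>m. (m, 0 :: 'a)) (m # l)) =
      four_block_mat (jordan_block m 0) (0\<^sub>m m ?s) (0\<^sub>m ?s m) ?D"
    by (simp add: jordan_matrix_Cons comp_def)
  then have "jordan_matrix (map (\<lambda>m. (m, 0 :: 'a)) (m # l)) ^\<^sub>m k =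
      four_block_mat (jordan_block m 0 ^\<^sub>m k) (0\<^sub>m m ?s) (0\<^sub>m ?s m) (?D ^\<^sub>m k)"
    using pow_four_block_mat[OF jordan_block_carrier D] by simp
  moreover have "?D ^\<^sub>m k \<in> carrier_mat ?s ?s" using D by simp
  ultimately show ?case
    using Cons.IH by (simp add: card_mat_kernel_block_diag nker_jordan_block power_add)
qed

text \<open>Similarity passes to powers, so kernel sizes can be read off the Jordan form. The
  exponent is the number of boxes in the first k columns of the Young diagram with rows
  \<open>l\<close>.\<close>

lemma nker_jordan_type:
  fixes A :: "'a::{field,finite} mat"
  assumes "has_jordan_type A l"
  shows "nker A k = CARD('a) ^ (\<Sum>m\<leftarrow>l. min k m)"
proof -
  have "similar_mat A (jordan_matrix (map (\<lambda>m. (m, 0)) l))"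
    using assms by (simp add: has_jordan_type_def jordan_nf_def)
  then have "similar_mat (A ^\<^sub>m k) (jordan_matrix (map (\<lambda>m. (m, 0)) l) ^\<^sub>m k)"
    unfolding similar_mat_def using similar_mat_wit_pow by blast
  then show ?thesis using card_mat_kernel_similar nker_jordan_matrix by metis
qed

text \<open>Triangularity provides a Jordan form over the field itself, and the characteristic
  polynomial X^n forces every eigenvalue in it to be 0. The list obtained need not be
  sorted.\<close>

lemma strictly_upper_triangular_jordan_type_exists:
  fixes A :: "'a::field mat"
  assumes A: "A \<in> carrier_mat n n" and upper: "strictly_upper_triangular A"
  obtains l where "has_jordan_type A l" "0 \<notin> set l"
proof -
  have ut: "upper_triangular A"
    using upper A by (auto simp: strictly_upper_triangular_def)
  from triangular_to_jnf_vector[OF A ut] obtain n_as where jnf: "jordan_nf A n_as" by blast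
  have "diag_mat A = replicate n 0"
    using A upper by (auto simp: diag_mat_def strictly_upper_triangular_def list_eq_iff_nth_eq)
  then have char: "char_poly A = [:0, 1:] ^ n"
    by (simp add: char_poly_upper_triangular[OF A ut])
  have zero: "a = 0" if mem: "(m, a) \<in> set n_as" for m a
  proof -
    \<comment> \<open>A block of size 0 would contribute a trivial factor, without a root at
      \<open>a\<close>.\<close>
    have "m \<noteq> 0" using mem jnf by (force simp: jordan_nf_def)
    moreover obtain xs ys where "n_as = xs @ (m, a) # ys" using split_list[OF mem] by blast
    ultimately have "poly (char_poly A) a = 0"
      unfolding jordan_nf_char_poly[OF jnf] by simp
    then show "a = 0" by (simp add: char)
  qed
  have "map (\<lambda>m. (m, 0)) (map fst n_as) = n_as"
    unfolding map_map by (rule map_idI) (auto dest: zero)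
  then have "has_jordan_type A (map fst n_as)"
    using jnf by (simp add: has_jordan_type_def)
  moreover have "0 \<notin> set (map fst n_as)" using jnf by (auto simp: jordan_nf_def)
  ultimately show ?thesis using that by blast
qed

text \<open>Conjugation by a block permutation matrix exchanges the two blocks. This compensates for
  the unsorted list of block sizes above.\<close>

lemma has_jordan_type_swap:
  fixes A :: "'a::field mat"
  assumes "has_jordan_type A [a, b]"
  shows "has_jordan_type A [b, a]"
proof -
  let ?J = "\<lambda>a. jordan_block a (0 :: 'a)"
  have J: "jordan_matrix [(a, 0), (b, 0)] = four_block_mat (?J a) (0\<^sub>m a b) (0\<^sub>m b a) (?J b)" for a b
  proof -
    have "jordan_matrix [(b, 0)] = ?J b"
      by (auto simp: jordan_matrix_def)
    then show ?thesis by (subst jordan_matrix_Cons) simp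
  qed
  define P where "P = (\<lambda>a b. four_block_mat (0\<^sub>m a b) (1\<^sub>m a) (1\<^sub>m b) (0\<^sub>m b a) :: 'a mat)"
  have P: "P a b \<in> carrier_mat (a + b) (b + a)" for a b by (simp add: P_def)
  have PP: "P a b * P b a = 1\<^sub>m (a + b)" for a b
    unfolding P_def by (subst mult_four_block_mat[of _ a b _ a _ b _ _ a _ b]) auto
  have "P a b * jordan_matrix [(b, 0), (a, 0)] * P b a = jordan_matrix [(a, 0), (b, 0)]"
    unfolding J P_def
    by (subst mult_four_block_mat[of _ a b _ a _ b _ _ b _ a], simp_all)
       (subst mult_four_block_mat[of _ a b _ a _ b _ _ a _ b], auto)
  then have "similar_mat (jordan_matrix [(a, 0 :: 'a), (b, 0)]) (jordan_matrix [(b, 0), (a, 0)])"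
    using P[of a b] P[of b a] PP[of a b] PP[of b a]
      jordan_matrix_carrier[of "[(a, 0 :: 'a), (b, 0)]"] jordan_matrix_carrier[of "[(b, 0 :: 'a), (a, 0)]"]
    by (intro similar_matI[of _ _ "P a b" "P b a" "a + b"]) (auto simp: add.commute)
  then show ?thesis
    using assms similar_mat_trans by (auto simp: has_jordan_type_def jordan_nf_def)
qed

text \<open>A substitute for \<open>has_jordan_type A [r, s]\<close> that also makes sense for s =
  0, where \<open>jordan_nf\<close> would reject the empty block. The recursion on boxes passes
  through these one-row shapes.\<close>

definition two_row_profile :: "'a::{field,finite} mat \<Rightarrow> nat \<Rightarrow> nat \<Rightarrow> bool" where
  "two_row_profile A r s \<longleftrightarrow> (\<forall>k. nker A k = CARD('a) ^ (min k r + min k s))"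

lemma one_less_CARD_field: "1 < CARD('a::{field,finite})"
proof -
  have "card {0, 1 :: 'a} \<le> CARD('a)" by (rule card_mono) auto
  then show ?thesis by simp
qed

lemma has_jordan_type_iff_two_row_profile:
  fixes A :: "'a::{field,finite} mat"
  assumes A: "A \<in> carrier_mat n n" and upper: "strictly_upper_triangular A"
    and "s \<ge> 1" "r \<ge> s"
  shows "has_jordan_type A [r, s] \<longleftrightarrow> two_row_profile A r s"
proof
  assume "has_jordan_type A [r, s]"
  then show "two_row_profile A r s"
    unfolding two_row_profile_def using nker_jordan_type by fastforce
next
  assume profile: "two_row_profile A r s"
  obtain l where l: "has_jordan_type A l" "0 \<notin> set l"
    using strictly_upper_triangular_jordan_type_exists[OF A upper] .
  have eq: "(\<Sum>m\<leftarrow>l. min k m) = min k r + min k s" for k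
    using profile nker_jordan_type[OF l(1), of k] one_less_CARD_field[where 'a = 'a]
    by (simp add: two_row_profile_def)
  \<comment> \<open>At k = 1 every nonempty block contributes 1, so the profile yields the number of
    blocks.\<close>
  have "(\<Sum>m\<leftarrow>l. min 1 m) = length l"
    using l(2) by (induction l) auto
  then have "length l = 2" using eq[of 1] assms(3,4) by simp
  then obtain a b where ab: "l = [a, b]"
    by (auto simp: numeral_2_eq_2 length_Suc_conv)
  have eq': "min k a + min k b = min k r + min k s" for k using eq[of k] ab by simp
  \<comment> \<open>A value of k beyond all parts gives the total size; k = r and k = max a b then
    determine the larger part.\<close>
  have "a + b = r + s" using eq'[of "a + b + r + s"] by simp
  moreover have "max a b = r"
    using eq'[of r] eq'[of "max a b"] \<open>a + b = r + s\<close> assms(4) by (auto simp: min_def max_def split: if_splits)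
  ultimately have "(a = r \<and> b = s) \<or> (a = s \<and> b = r)" by linarith
  then show "has_jordan_type A [r, s]"
    using l(1) ab has_jordan_type_swap by blast
qed

section \<open>Recurrence for two-row Jordan types\<close>

text \<open>The vectors whose least growth index is j. As a border, such a vector adds its box in
  column j + 1 of the Young diagram, columns being counted from 1.\<close>

definition growth_layer :: "'a::field mat \<Rightarrow> nat \<Rightarrow> 'a vec set" where
  "growth_layer A j = {v \<in> growth_space A j. \<forall>i<j. v \<notin> growth_space A i}"

lemma finite_growth_space [simp]:
  "finite (growth_space (A :: 'a::{field,finite} mat) k)"
  unfolding growth_space_def by (rule finite_subset[OF _ finite_carrier_vec[of "dim_row A"]]) auto

lemma finite_growth_layer [simp]:
  "finite (growth_layer (A :: 'a::{field,finite} mat) k)"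
  unfolding growth_layer_def by simp

lemma growth_layer_carrier: "A \<in> carrier_mat n n \<Longrightarrow> growth_layer A j \<subseteq> carrier_vec n"
  by (auto simp: growth_layer_def growth_space_def)

lemma growth_layer_0: "growth_layer A 0 = growth_space A 0"
  by (simp add: growth_layer_def)

lemma growth_layer_Suc:
  assumes "A \<in> carrier_mat n n"
  shows "growth_layer A (Suc j) = growth_space A (Suc j) - growth_space A j"
  using growth_space_mono[OF assms] by (auto simp: growth_layer_def less_Suc_eq_le)

lemma nker_bordered_mat_layer:
  fixes A :: "'a::{field,finite} mat"
  assumes A: "A \<in> carrier_mat n n" and v: "v \<in> growth_layer A j"
  shows "nker (bordered_mat A v) k = (if j < k then CARD('a) else 1) * nker A k"
proof (cases k)
  case 0
  then show ?thesis using nker_0[OF A] nker_0[OF bordered_mat_carrier[OF A, of v]] by simp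
next
  case (Suc m)
  have "v \<in> growth_space A m \<longleftrightarrow> j \<le> m"
    using v growth_space_mono[OF A, of j m] by (cases "j \<le> m") (auto simp: growth_layer_def)
  then show ?thesis
    using nker_bordered_mat[OF A subsetD[OF growth_layer_carrier[OF A] v], of m] Suc
    by (simp add: less_Suc_eq_le del: pow_mat.simps)
qed

text \<open>Undoing the border removes one box, and what remains has to be a Young diagram. The box
  thus ends the first row (only if s < r) or the second, and its column number minus 1 is the layer
  of \<open>v\<close>.\<close>

lemma two_row_profile_bordered_mat:
  fixes A :: "'a::{field,finite} mat"
  assumes A: "A \<in> carrier_mat n n" and v: "v \<in> carrier_vec n"
    and n: "r + s = Suc n" and "s \<le> r"
  shows "two_row_profile (bordered_mat A v) r s \<longleftrightarrow>
    (s < r \<and> two_row_profile A (r - 1) s \<and> v \<in> growth_layer A (r - 1)) \<or>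
    (1 \<le> s \<and> two_row_profile A r (s - 1) \<and> v \<in> growth_layer A (s - 1))"
    (is "?l \<longleftrightarrow> ?r1 \<or> ?r2")
proof -
  let ?q = "CARD('a)"
  have q: "1 < ?q" by (rule one_less_CARD_field)
  have r: "1 \<le> r" using n \<open>s \<le> r\<close> by linarith
  show ?thesis
  proof
    assume l: ?l
    let ?d = "\<lambda>k. min k r + min k s"
    have d: "nker (bordered_mat A v) k = ?q ^ ?d k" for k
      using l by (simp add: two_row_profile_def)
    \<comment> \<open>Otherwise the border would not enlarge the kernel of the power r + 1, and A of
      size n would have q^(n+1) kernel vectors.\<close>
    have "v \<in> growth_space A r"
    proof (rule ccontr)
      assume "v \<notin> growth_space A r"
      then have "nker A (Suc r) = ?q ^ Suc n"
        using nker_bordered_mat[OF A v, of r] d[of "Suc r"] n \<open>s \<le> r\<close> by (simp del: pow_mat.simps power_Suc)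
      moreover have "nker A (Suc r) \<le> ?q ^ n"
        unfolding card_carrier_vec[symmetric] using A
        by (intro card_mono) (auto simp: mat_kernel_def simp del: pow_mat.simps)
      ultimately show False using q by simp
    qed
    then obtain j where j: "v \<in> growth_layer A j"
      using exists_least_iff[of "\<lambda>k. v \<in> growth_space A k"] by (auto simp: growth_layer_def)
    have e: "nker A k = ?q ^ (?d k - (if j < k then 1 else 0))" for k
    proof (cases "j < k")
      case True
      then have "?d k = Suc (?d k - 1)" using r by auto
      then have "?q ^ ?d k = ?q * ?q ^ (?d k - 1)" by (metis power_Suc)
      then show ?thesis
        using nker_bordered_mat_layer[OF A j, of k] d[of k] True q by simp
    qed (use nker_bordered_mat_layer[OF A j, of k] d[of k] in simp)
    have "?q ^ (?d j + (?d (Suc (Suc j)) - 1)) \<le> ?q ^ ((?d (Suc j) - 1) * 2)"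
      using nker_log_concave[OF A, of j] unfolding e by (simp flip: power_add power_mult)
    then have le: "?d j + (?d (Suc (Suc j)) - 1) \<le> (?d (Suc j) - 1) * 2"
      by (rule power_le_imp_le_exp[OF q])
    \<comment> \<open>The exponents of A have their increment at j + 1 lowered by 1. By
      log-concavity the increments of \<open>?d\<close> must drop right after j + 1, which happens
      only at s and r.\<close>
    have kink: "Suc j = r \<or> Suc j = s"
    proof (rule ccontr)
      assume "\<not> (Suc j = r \<or> Suc j = s)"
      then consider "Suc j < s" | "s < Suc j" "Suc j < r" | "r < Suc j" by linarith
      then show False using le \<open>s \<le> r\<close> r by cases auto
    qed
    \<comment> \<open>For r = s the only removable box ends the second row, so that row is tested
      first.\<close>
    show "?r1 \<or> ?r2"
    proof (cases "Suc j = s")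
      case True
      then have "?d k - (if j < k then 1 else 0) = min k r + min k (s - 1)" for k by auto
      then show ?thesis using True j e by (auto simp: two_row_profile_def)
    next
      case False
      then have "Suc j = r" "s < r" using kink \<open>s \<le> r\<close> by auto
      then have "?d k - (if j < k then 1 else 0) = min k (r - 1) + min k s" for k by auto
      then show ?thesis using \<open>Suc j = r\<close> \<open>s < r\<close> j e by (auto simp: two_row_profile_def)
    qed
  next
    assume "?r1 \<or> ?r2"
    then show ?l
    proof
      assume h: ?r1
      show ?l unfolding two_row_profile_def
      proof
        fix k
        have split: "min k r + min k s = (if r - 1 < k then 1 else 0) + (min k (r - 1) + min k s)" using h by auto
        have "nker (bordered_mat A v) k = (if r - 1 < k then ?q else 1) * ?q ^ (min k (r - 1) + min k s)"
          using nker_bordered_mat_layer[OF A, of v "r - 1" k] h unfolding two_row_profile_def by metis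
        then show "nker (bordered_mat A v) k = ?q ^ (min k r + min k s)"
          unfolding split power_add[of _ "if _ then _ else _"] by simp
      qed
    next
      assume h: ?r2
      show ?l unfolding two_row_profile_def
      proof
        fix k
        have split: "min k r + min k s = (if s - 1 < k then 1 else 0) + (min k r + min k (s - 1))" using h by auto
        have "nker (bordered_mat A v) k = (if s - 1 < k then ?q else 1) * ?q ^ (min k r + min k (s - 1))"
          using nker_bordered_mat_layer[OF A, of v "s - 1" k] h unfolding two_row_profile_def by metis
        then show "nker (bordered_mat A v) k = ?q ^ (min k r + min k s)"
          unfolding split power_add[of _ "if _ then _ else _"] by simp
      qed
    qed
  qed
qed

text \<open>The exponent is prescribed by an additive equation, which avoids truncated subtraction
  and lets the common power of q be cancelled.\<close>

lemma card_growth_space_profile: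
  fixes A :: "'a::{field,finite} mat"
  assumes A: "A \<in> carrier_mat n n" and profile: "two_row_profile A r s"
    and m: "m + (min (Suc k) r + min (Suc k) s) = n + (min k r + min k s)"
  shows "card (growth_space A k) = CARD('a) ^ m"
proof -
  let ?q = "CARD('a)" and ?e = "min (Suc k) r + min (Suc k) s"
  have "card (growth_space A k) * ?q ^ ?e = ?q ^ m * ?q ^ ?e"
    using card_growth_space[OF A, of k] profile unfolding two_row_profile_def
    by (simp add: m del: pow_mat.simps flip: power_add)
  then show ?thesis by simp
qed

lemma card_growth_layer_Suc:
  fixes A :: "'a::{field,finite} mat"
  assumes A: "A \<in> carrier_mat n n"
  shows "int (card (growth_layer A (Suc j))) =
    int (card (growth_space A (Suc j))) - int (card (growth_space A j))"
  unfolding growth_layer_Suc[OF A]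
  using growth_space_mono[OF A, of j "Suc j"]
  by (simp add: card_Diff_subset card_mono of_nat_diff)

section \<open>Counting by the removal of the last row and column\<close>

definition two_row_mats :: "nat \<Rightarrow> nat \<Rightarrow> 'a::{field,finite} mat set" where
  "two_row_mats r s =
     {A \<in> carrier_mat (r + s) (r + s). strictly_upper_triangular A \<and> two_row_profile A r s}"

lemma finite_carrier_mat: "finite (carrier_mat n m :: 'a::finite mat set)"
proof (rule finite_subset)
  let ?f = "\<lambda>f. mat n m (\<lambda>ij. if ij \<in> {..<n} \<times> {..<m} then f ij else undefined)"
  show "carrier_mat n m \<subseteq> ?f ` PiE ({..<n} \<times> {..<m}) (\<lambda>_. UNIV :: 'a set)"
  proof
    fix A :: "'a mat" assume "A \<in> carrier_mat n m"
    then have "A = ?f (restrict (\<lambda>ij. A $$ ij) ({..<n} \<times> {..<m}))" by (intro eq_matI) auto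
    then show "A \<in> ?f ` PiE ({..<n} \<times> {..<m}) (\<lambda>_. UNIV)" 
      by (intro image_eqI[of _ _ "restrict (\<lambda>ij. A $$ ij) ({..<n} \<times> {..<m})"]) auto
  qed
  show "finite (?f ` PiE ({..<n} \<times> {..<m}) (\<lambda>_. UNIV :: 'a set))"
    by (intro finite_imageI finite_PiE) auto
qed

lemma finite_two_row_mats [simp]: "finite (two_row_mats r s)"
  unfolding two_row_mats_def by (rule finite_subset[OF _ finite_carrier_mat]) auto

lemma strictly_upper_triangular_bordered_mat:
  assumes A: "A \<in> carrier_mat n n" and v: "v \<in> carrier_vec n" and "strictly_upper_triangular A"
  shows "strictly_upper_triangular (bordered_mat A v)"
  unfolding strictly_upper_triangular_def
proof (intro allI impI)
  fix i j assume "i < dim_row (bordered_mat A v)" "j \<le> i"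
  then have "i < Suc n" "j < Suc n" "j \<le> i" using bordered_mat_carrier[OF A, of v] by auto
  then show "bordered_mat A v $$ (i, j) = 0"
    using assms by (auto simp: bordered_mat_index[OF A v] strictly_upper_triangular_def)
qed

text \<open>The last row of a strictly upper triangular matrix vanishes, corner included, so the
  leading block and the last column determine the matrix and can be chosen independently.\<close>

lemma bordered_mat_bij:
  "bij_betw (\<lambda>(A, v). bordered_mat A v)
    ({A \<in> carrier_mat n n. strictly_upper_triangular A} \<times> carrier_vec n)
    {A :: 'a::field mat. A \<in> carrier_mat (Suc n) (Suc n) \<and> strictly_upper_triangular A}"
proof (rule bij_betw_byWitness[where f' = "\<lambda>B. (mat n n (\<lambda>ij. B $$ ij), vec n (\<lambda>i. B $$ (i, n)))"])
  show "(\<lambda>(A, v). bordered_mat A v) `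
      ({A \<in> carrier_mat n n. strictly_upper_triangular A} \<times> carrier_vec n)
      \<subseteq> {A :: 'a mat. A \<in> carrier_mat (Suc n) (Suc n) \<and> strictly_upper_triangular A}"
    using strictly_upper_triangular_bordered_mat bordered_mat_carrier by auto
  show "\<forall>p\<in>{A :: 'a mat. A \<in> carrier_mat n n \<and> strictly_upper_triangular A} \<times> carrier_vec n.
      (mat n n (\<lambda>ij. (case p of (A, v) \<Rightarrow> bordered_mat A v) $$ ij),
        vec n (\<lambda>i. (case p of (A, v) \<Rightarrow> bordered_mat A v) $$ (i, n))) = p"
    by (auto simp: bordered_mat_index intro!: eq_matI eq_vecI)
  show "\<forall>B\<in>{A :: 'a mat. A \<in> carrier_mat (Suc n) (Suc n) \<and> strictly_upper_triangular A}.
      (case (mat n n (\<lambda>ij. B $$ ij), vec n (\<lambda>i. B $$ (i, n))) of (A, v) \<Rightarrow> bordered_mat A v) = B"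
  proof clarify
    fix B :: "'a mat" assume B: "B \<in> carrier_mat (Suc n) (Suc n)" "strictly_upper_triangular B"
    let ?A = "mat n n (\<lambda>ij. B $$ ij)" and ?v = "vec n (\<lambda>i. B $$ (i, n))"
    have "bordered_mat ?A ?v \<in> carrier_mat (Suc n) (Suc n)" by (rule bordered_mat_carrier) simp
    then show "bordered_mat ?A ?v = B"
      using B by (intro eq_matI)
        (auto simp: bordered_mat_index[of _ n] strictly_upper_triangular_def less_Suc_eq)
  qed
  show "(\<lambda>B. (mat n n (\<lambda>ij. B $$ ij), vec n (\<lambda>i. B $$ (i, n)))) `
      {A :: 'a mat. A \<in> carrier_mat (Suc n) (Suc n) \<and> strictly_upper_triangular A}
      \<subseteq> {A \<in> carrier_mat n n. strictly_upper_triangular A} \<times> carrier_vec n"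
    by (auto simp: strictly_upper_triangular_def)
qed

text \<open>Matrices are sorted by the row of the Young diagram that received the last box:
  \<open>X\<close> collects the pairs for the first row, \<open>Y\<close> those for the
  second.\<close>

lemma card_two_row_mats:
  assumes "s \<le> r" "1 \<le> r"
  shows "card (two_row_mats r s :: 'a::{field,finite} mat set) =
    (if s < r then \<Sum>A\<in>(two_row_mats (r - 1) s :: 'a mat set). card (growth_layer A (r - 1)) else 0) +
    (if 1 \<le> s then \<Sum>A\<in>(two_row_mats r (s - 1) :: 'a mat set). card (growth_layer A (s - 1)) else 0)"
proof -
  obtain n where n: "r + s = Suc n" using assms by (cases "r + s") auto
  let ?U = "\<lambda>n. {A :: 'a mat. A \<in> carrier_mat n n \<and> strictly_upper_triangular A}"
  define X where "X = (if s < r then SIGMA A:(two_row_mats (r - 1) s :: 'a mat set). growth_layer A (r - 1) else {})"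
  define Y where "Y = (if 1 \<le> s then SIGMA A:(two_row_mats r (s - 1) :: 'a mat set). growth_layer A (s - 1) else {})"
  have "{p \<in> ?U n \<times> carrier_vec n. case p of (A, v) \<Rightarrow> two_row_profile (bordered_mat A v) r s} = X \<union> Y"
    (is "?S = _")
  proof -
    have X_iff: "(A, v) \<in> X \<longleftrightarrow>
        A \<in> ?U n \<and> s < r \<and> two_row_profile A (r - 1) s \<and> v \<in> growth_layer A (r - 1)" for A v
    proof (cases "s < r")
      case True
      then have "r - 1 + s = n" using n by simp
      then show ?thesis using True by (auto simp: X_def two_row_mats_def)
    qed (simp add: X_def)
    have Y_iff: "(A, v) \<in> Y \<longleftrightarrow>
        A \<in> ?U n \<and> 1 \<le> s \<and> two_row_profile A r (s - 1) \<and> v \<in> growth_layer A (s - 1)" for A v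
    proof (cases "1 \<le> s")
      case True
      then have "r + (s - 1) = n" using n by simp
      then show ?thesis using True by (auto simp: Y_def two_row_mats_def)
    qed (simp add: Y_def)
    have *: "(A, v) \<in> ?S \<longleftrightarrow> (A, v) \<in> X \<union> Y" for A v
    proof (cases "A \<in> ?U n \<and> v \<in> carrier_vec n")
      case True
      then have "A \<in> carrier_mat n n" "v \<in> carrier_vec n" by auto
      from two_row_profile_bordered_mat[OF this n \<open>s \<le> r\<close>] show ?thesis
        using True unfolding Un_iff X_iff Y_iff by simp
    next
      case False
      then show ?thesis
        using subsetD[OF growth_layer_carrier[of A n]] unfolding Un_iff X_iff Y_iff by blast
    qed
    show ?thesis by (intro equalityI subrelI) (use * in blast)+
  qed
  moreover have "two_row_mats r s =
      (\<lambda>(A, v). bordered_mat A v) ` ?S"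
  proof -
    have "two_row_mats r s = {B \<in> ?U (Suc n). two_row_profile B r s}"
      using n by (auto simp: two_row_mats_def)
    then show ?thesis
      unfolding bij_betw_imp_surj_on[OF bordered_mat_bij, symmetric] by auto
  qed
  moreover have "inj_on (\<lambda>(A, v). bordered_mat A v) ?S"
    by (rule inj_on_subset[OF bij_betw_imp_inj_on[OF bordered_mat_bij]]) auto
  ultimately have "card (two_row_mats r s :: 'a mat set) = card (X \<union> Y)"
    by (simp add: card_image)
  also have "\<dots> = card X + card Y"
  proof (rule card_Un_disjoint)
    show "finite X" "finite Y" by (auto simp: X_def Y_def)
    \<comment> \<open>If both sets are present then s - 1 < r - 1, and a vector lies in at most one
      layer.\<close>
    show "X \<inter> Y = {}" by (auto simp: X_def Y_def growth_layer_def)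
  qed
  finally show ?thesis by (simp add: X_def Y_def)
qed

text \<open>The new box goes to column r + 1. That column of the shape of A is empty, so growth
  space r is everything; column r has length 1 or 2, which is the codimension of growth space r -
  1.\<close>

lemma card_growth_layer_first_row:
  fixes A :: "'a::{field,finite} mat"
  assumes A: "A \<in> two_row_mats r s"
  defines "q \<equiv> int CARD('a)"
  shows "r = 0 \<Longrightarrow> s = 0 \<Longrightarrow> int (card (growth_layer A r)) = 1"
    and "s < r \<Longrightarrow> int (card (growth_layer A r)) = q ^ (r + s) - q ^ (r + s - 1)"
    and "s = r \<Longrightarrow> 1 \<le> r \<Longrightarrow> int (card (growth_layer A r)) = q ^ (r + s) - q ^ (r + s - 2)"
proof -
  have c: "A \<in> carrier_mat (r + s) (r + s)" and p: "two_row_profile A r s"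
    using A by (auto simp: two_row_mats_def)
  note g = card_growth_space_profile[OF c p]
  show "int (card (growth_layer A r)) = 1" if "r = 0" "s = 0"
    using g[of 0 0] that by (simp add: growth_layer_0)
  show "int (card (growth_layer A r)) = q ^ (r + s) - q ^ (r + s - 1)" if h: "s < r"
  proof -
    obtain t where t: "r = Suc t" using h by (cases r) auto
    show ?thesis
      using g[of "r + s" r] g[of "r + s - 1" t] that card_growth_layer_Suc[OF c, of t]
      by (simp add: t q_def)
  qed
  show "int (card (growth_layer A r)) = q ^ (r + s) - q ^ (r + s - 2)" if h: "s = r" "1 \<le> r"
  proof -
    obtain t where t: "r = Suc t" using h by (cases r) auto
    show ?thesis
      using g[of "r + s" r] g[of "r + s - 2" t] that card_growth_layer_Suc[OF c, of t]
      by (simp add: t q_def)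
  qed
qed

text \<open>The new box goes to column s + 1, of length 1 before, while column s has length 2. For s
  = 0 there is no preceding column, hence nothing is subtracted.\<close>

lemma card_growth_layer_second_row:
  fixes A :: "'a::{field,finite} mat"
  assumes A: "A \<in> two_row_mats r s" and "s < r"
  defines "q \<equiv> int CARD('a)"
  shows "s = 0 \<Longrightarrow> int (card (growth_layer A s)) = q ^ (r + s - 1)"
    and "1 \<le> s \<Longrightarrow> int (card (growth_layer A s)) = q ^ (r + s - 1) - q ^ (r + s - 2)"
proof -
  have c: "A \<in> carrier_mat (r + s) (r + s)" and p: "two_row_profile A r s"
    using A by (auto simp: two_row_mats_def)
  note g = card_growth_space_profile[OF c p]
  show "int (card (growth_layer A s)) = q ^ (r + s - 1)" if "s = 0"
    using g[of "r - 1" 0] that \<open>s < r\<close> by (simp add: growth_layer_0 q_def)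
  show "int (card (growth_layer A s)) = q ^ (r + s - 1) - q ^ (r + s - 2)" if h: "1 \<le> s"
  proof -
    obtain t where t: "s = Suc t" using h by (cases s) auto
    show ?thesis
      using g[of "r + s - 1" s] g[of "r + s - 2" t] that \<open>s < r\<close> card_growth_layer_Suc[OF c, of t]
      by (simp add: t q_def)
  qed
qed

section \<open>Solution of the recurrence\<close>

text \<open>Pascal's rule for both binomials. The case split on \<open>i\<close> follows the
  separate clause for k = 0 in \<open>gen_catalan\<close>.\<close>

lemma gen_catalan_rec:
  "gen_catalan (Suc m) (Suc i) = gen_catalan m (Suc i) + gen_catalan (Suc m) i"
  by (cases i) (simp_all add: gen_catalan_def)

lemma gen_catalan_above_diagonal: "gen_catalan m (Suc m) = 0"
  using binomial_symmetric[of m "m + Suc m"] by (simp add: gen_catalan_def)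

definition catalan_sum :: "int \<Rightarrow> nat \<Rightarrow> nat \<Rightarrow> int" where
  "catalan_sum q r s = (\<Sum>i = 0..s. gen_catalan (r + s - i) i * q ^ i)"

lemma catalan_sum_0: "catalan_sum q r 0 = 1"
  by (simp add: catalan_sum_def gen_catalan_def)

lemma catalan_sum_Suc:
  "catalan_sum q r (Suc s) = 1 + (\<Sum>i = 0..s. gen_catalan (r + s - i) (Suc i) * q ^ Suc i)"
  unfolding catalan_sum_def sum.atLeast0_atMost_Suc_shift by (simp add: gen_catalan_def[of _ 0])

text \<open>The ballot recurrence term by term; shifting the index in its second part produces the
  factor q.\<close>

lemma catalan_sum_rec:
  "catalan_sum q (Suc r) (Suc s) = catalan_sum q r (Suc s) + q * catalan_sum q (Suc r) s"
proof -
  have "catalan_sum q (Suc r) (Suc s) =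
      1 + (\<Sum>i = 0..s. gen_catalan (Suc (r + s - i)) (Suc i) * q ^ Suc i)"
    by (simp add: catalan_sum_Suc Suc_diff_le cong: sum.cong_simp del: power_Suc)
  also have "\<dots> = 1 + (\<Sum>i = 0..s. gen_catalan (r + s - i) (Suc i) * q ^ Suc i) +
      q * (\<Sum>i = 0..s. gen_catalan (Suc (r + s - i)) i * q ^ i)"
    by (simp add: gen_catalan_rec sum.distrib sum_distrib_left algebra_simps)
  also have "1 + (\<Sum>i = 0..s. gen_catalan (r + s - i) (Suc i) * q ^ Suc i) = catalan_sum q r (Suc s)"
    by (simp add: catalan_sum_Suc del: power_Suc)
  also have "(\<Sum>i = 0..s. gen_catalan (Suc (r + s - i)) i * q ^ i) = catalan_sum q (Suc r) s"
    by (simp add: catalan_sum_def Suc_diff_le cong: sum.cong_simp)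
  finally show ?thesis .
qed

text \<open>The top term of \<open>catalan_sum q s (Suc s)\<close> is a ballot number just beyond
  the diagonal and vanishes, so both summands of the recurrence involve the same sum.\<close>

lemma catalan_sum_diagonal:
  "catalan_sum q (Suc s) (Suc s) = (1 + q) * catalan_sum q (Suc s) s"
proof -
  have "catalan_sum q s (Suc s) = catalan_sum q (Suc s) s"
    by (simp add: catalan_sum_def gen_catalan_above_diagonal)
  then show ?thesis by (simp add: catalan_sum_rec[of q s s] algebra_simps)
qed

lemma Suc_choose_two: "Suc m choose 2 = m + (m choose 2)"
  by (simp add: numeral_2_eq_2)

text \<open>Here \<open>g\<close> stands for the counts and \<open>w r s\<close> for the number of
  ways to add a box to the second row of shape (r, s). The factor \<open>q ^ (2 * s)\<close> stays
  on the left to keep exponents free of subtraction of 2s.\<close>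

lemma two_row_recurrence_solution:
  fixes q :: int and g :: "nat \<Rightarrow> nat \<Rightarrow> int"
  assumes "q \<noteq> 0"
    and g_1_0: "g 1 0 = 1"
    and g_0: "\<And>r. g (Suc (Suc r)) 0 = g (Suc r) 0 * (q ^ (r + 1) - q ^ r)"
    and g_diag: "\<And>s. g (Suc s) (Suc s) = g (Suc s) s * w (Suc s) s"
    and g_first: "\<And>s. 1 \<le> s \<Longrightarrow>
      g (Suc s) s = g s s * (q ^ (2 * s) - q ^ (2 * s - 2)) + g (Suc s) (s - 1) * w (Suc s) (s - 1)"
    and g_step: "\<And>r s. s < r \<Longrightarrow> 1 \<le> s \<Longrightarrow>
      g (Suc r) s = g r s * (q ^ (r + s) - q ^ (r + s - 1)) + g (Suc r) (s - 1) * w (Suc r) (s - 1)"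
    and w: "\<And>r s. w r s = (if s = 0 then q ^ (r - 1) else q ^ (r + s - 1) - q ^ (r + s - 2))"
  shows "1 \<le> s \<Longrightarrow> s < r \<Longrightarrow>
      g r s * q ^ (2 * s) = (q - 1) ^ (r + s - 2) * q ^ (((r + s - 1) choose 2) + 1) * catalan_sum q r s"
    and "1 \<le> r \<Longrightarrow> g r r = (q - 1) ^ (2 * r - 2) * q ^ ((2 * r - 2) choose 2) * catalan_sum q r (r - 1)"
proof -
  have col: "g (Suc r) 0 = (q - 1) ^ r * q ^ (r choose 2)" for r
  proof (induction r)
    case (Suc r)
    then show ?case using g_0[of r] by (simp add: Suc_choose_two power_add algebra_simps)
  qed (use g_1_0 in \<open>simp add: numeral_2_eq_2\<close>)
  define G where "G = (\<lambda>r s. g r s * q ^ (2 * s) =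
    (q - 1) ^ (r + s - 2) * q ^ (((r + s - 1) choose 2) + 1) * catalan_sum q r s)"
  define D where "D = (\<lambda>r. g r r =
    (q - 1) ^ (2 * r - 2) * q ^ ((2 * r - 2) choose 2) * catalan_sum q r (r - 1))"
  \<comment> \<open>One formula covers both forms of \<open>w\<close>: for s = 0 the weight lacks a
    factor q - 1, but the one-row count \<open>col\<close> has one more than the two-row
    counts.\<close>
  have second: "g (Suc r) s * w (Suc r) s * q ^ (2 * Suc s) =
      (q - 1) ^ (r + s) * q ^ ((Suc (r + s) choose 2) + 1) * (q * catalan_sum q (Suc r) s)"
    if "s \<le> r" "1 \<le> s \<longrightarrow> G (Suc r) s" for r s
  proof (cases s)
    case 0
    then show ?thesis
      by (simp add: w col catalan_sum_0 Suc_choose_two power_add power2_eq_square algebra_simps)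
  next
    case (Suc t)
    have wq: "w (Suc r) s = (q - 1) * q ^ (r + t)"
      by (simp add: w Suc algebra_simps)
    have "g (Suc r) s * w (Suc r) s * q ^ (2 * Suc s) =
        g (Suc r) s * q ^ (2 * s) * (q - 1) * q ^ (r + t + 2)"
      by (simp add: wq power_add power2_eq_square algebra_simps)
    also have "g (Suc r) s * q ^ (2 * s) =
        (q - 1) ^ (r + t) * q ^ (((r + s) choose 2) + 1) * catalan_sum q (Suc r) s"
      using that Suc by (simp add: G_def)
    finally show ?thesis
      by (simp add: Suc Suc_choose_two power_add power2_eq_square algebra_simps)
  qed
  \<comment> \<open>Both formulas are proved together: shapes (s + 1, s) draw on the diagonal shape
    (s, s), and diagonal shapes draw on (r, r - 1).\<close>
  have "(1 \<le> s \<longrightarrow> s < r \<longrightarrow> G r s) \<and> (s = r \<longrightarrow> 1 \<le> r \<longrightarrow> D r)" for r s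
  proof (induction "r + s" arbitrary: r s rule: less_induct)
    case less
    have IH_G: "G r' s'" if "r' + s' < r + s" "1 \<le> s'" "s' < r'" for r' s'
      using less[of r' s'] that by simp
    have IH_D: "D r'" if "r' + r' < r + s" "1 \<le> r'" for r'
      using less[of r' r'] that by simp
    show ?case
    proof (intro conjI impI)
      assume s: "1 \<le> s" "s < r"
      obtain t where t: "s = Suc t" using s by (cases s) auto
      obtain a where a: "r = Suc a" using s by (cases r) auto
      have snd: "g r t * w r t * q ^ (2 * s) =
          (q - 1) ^ (a + t) * q ^ ((Suc (a + t) choose 2) + 1) * (q * catalan_sum q r t)"
        using second[of t a] IH_G[of r t] s by (simp add: a t)
      \<comment> \<open>If the first-row contribution \<open>u\<close> carries the same prefactor as
        \<open>snd\<close>, the two sums combine by \<open>catalan_sum_rec\<close>.\<close>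
      have main: "G r s" if fst: "g r s = u + g r t * w r t"
        "u * q ^ (2 * s) = (q - 1) ^ (a + t) * q ^ ((Suc (a + t) choose 2) + 1) * catalan_sum q a s" for u
        unfolding G_def fst distrib_right snd that(2)
        by (simp add: a t catalan_sum_rec distrib_left)
      show "G r s"
      proof (cases "s < a")
        case True
        have "g a s * q ^ (2 * s) = (q - 1) ^ (a + t - 1) * q ^ (((a + t) choose 2) + 1) * catalan_sum q a s"
          using IH_G[of a s] True s by (simp add: G_def a t)
        moreover obtain m where m: "a + t = Suc m" using True by (cases "a + t") auto
        moreover have diff: "q ^ (a + s) - q ^ (a + s - 1) = (q - 1) * q ^ (a + t)"
          by (simp add: t algebra_simps)
        ultimately have "g a s * q ^ (2 * s) * (q ^ (a + s) - q ^ (a + s - 1)) =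
            (q - 1) ^ (a + t) * q ^ ((Suc (a + t) choose 2) + 1) * catalan_sum q a s"
          unfolding diff by (simp add: Suc_choose_two[of "Suc m"] power_add ac_simps)
        then have "g a s * (q ^ (a + s) - q ^ (a + s - 1)) * q ^ (2 * s) =
            (q - 1) ^ (a + t) * q ^ ((Suc (a + t) choose 2) + 1) * catalan_sum q a s"
          by (simp only: ac_simps)
        then show ?thesis using main[of "g a s * (q ^ (a + s) - q ^ (a + s - 1))"] g_step[OF True s(1)]
          by (simp add: a t)
      next
        case False
        then have as: "a = s" using s a by simp
        have D: "g s s = (q - 1) ^ (2 * t) * q ^ ((2 * t) choose 2) * catalan_sum q s t"
          using IH_D[of s] s by (simp add: D_def t)
        \<comment> \<open>Column lengths drop by 2 here, giving q^2 - 1 = (q - 1)(q + 1). The factor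
          q + 1 is the one in \<open>catalan_sum_diagonal\<close>.\<close>
        have "q ^ (2 * s) - q ^ (2 * s - 2) = q ^ (2 * t) * ((q - 1) * (1 + q))"
          by (simp add: t algebra_simps)
        then have "g s s * (q ^ (2 * s) - q ^ (2 * s - 2)) * q ^ (2 * s) =
            (q - 1) ^ (2 * t + 1) * q ^ (((2 * t) choose 2) + 2 * t + 2 * s) * ((1 + q) * catalan_sum q s t)"
          unfolding D by (simp add: power_add ac_simps)
        also have "((2 * t) choose 2) + 2 * t + 2 * s = (Suc (a + t) choose 2) + 1"
          unfolding as t by (simp add: Suc_choose_two mult_2)
        also have "2 * t + 1 = a + t" by (simp add: as t)
        also have "(1 + q) * catalan_sum q s t = catalan_sum q a s"
          by (simp add: as t catalan_sum_diagonal)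
        finally show ?thesis using main[of "g s s * (q ^ (2 * s) - q ^ (2 * s - 2))"] g_first[OF s(1)]
          by (simp add: a as t)
      qed
    next
      assume s: "s = r" "1 \<le> r"
      obtain t where t: "r = Suc t" using s by (cases r) auto
      have "g r r * q ^ (2 * r) = (q - 1) ^ (2 * t) * q ^ ((Suc (2 * t) choose 2) + 1) * (q * catalan_sum q r t)"
        using second[of t t] IH_G[of r t] s by (simp add: t g_diag mult_2)
      \<comment> \<open>The exponent (2t + 1 choose 2) + 2 equals (2t choose 2) + 2r, so
        \<open>q ^ (2 * r)\<close> can be cancelled.\<close>
      also have "\<dots> = (q - 1) ^ (2 * t) * q ^ ((2 * t) choose 2) * catalan_sum q r t * q ^ (2 * r)"
        by (simp add: t Suc_choose_two power_add)
      finally show "D r" using \<open>q \<noteq> 0\<close> by (simp add: D_def t)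
    qed
  qed
  then show "1 \<le> s \<Longrightarrow> s < r \<Longrightarrow>
      g r s * q ^ (2 * s) = (q - 1) ^ (r + s - 2) * q ^ (((r + s - 1) choose 2) + 1) * catalan_sum q r s"
    and "1 \<le> r \<Longrightarrow> g r r = (q - 1) ^ (2 * r - 2) * q ^ ((2 * r - 2) choose 2) * catalan_sum q r (r - 1)"
    unfolding G_def D_def by blast+
qed

section \<open>The closed form for matrices and its transfer to Jordan types\<close>

lemma card_two_row_mats_0_0: "card (two_row_mats 0 0 :: 'a::{field,finite} mat set) = 1"
proof -
  have "nker A k = 1" if A: "A \<in> carrier_mat 0 0" for A :: "'a mat" and k
  proof -
    have "nker A k \<le> card (carrier_vec 0 :: 'a vec set)"
      using A by (intro card_mono) (auto simp: mat_kernel_def)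
    then show ?thesis using nker_pos[OF A, of k] by (simp add: card_carrier_vec)
  qed
  then have "two_row_mats 0 0 = (carrier_mat 0 0 :: 'a mat set)"
    by (auto simp: two_row_mats_def two_row_profile_def strictly_upper_triangular_def)
  also have "\<dots> = {0\<^sub>m 0 0}" by (auto intro: eq_matI)
  finally show ?thesis by simp
qed

lemma sum_card_eq_const:
  assumes "\<And>A. A \<in> T \<Longrightarrow> int (card (f A)) = c"
  shows "int (\<Sum>A\<in>T. card (f A)) = int (card T) * c"
  using assms by simp

lemma card_two_row_mats_closed_form:
  fixes r s :: nat
  defines "q \<equiv> int CARD('a::{field,finite})"
  shows "1 \<le> s \<Longrightarrow> s < r \<Longrightarrow> int (card (two_row_mats r s :: 'a mat set)) * q ^ (2 * s) =
      (q - 1) ^ (r + s - 2) * q ^ (((r + s - 1) choose 2) + 1) * catalan_sum q r s"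
    and "1 \<le> r \<Longrightarrow> int (card (two_row_mats r r :: 'a mat set)) =
      (q - 1) ^ (2 * r - 2) * q ^ ((2 * r - 2) choose 2) * catalan_sum q r (r - 1)"
proof -
  define w where "w = (\<lambda>r s. if s = 0 then q ^ (r - 1) else q ^ (r + s - 1) - q ^ (r + s - 2))"
  define T where "T = (two_row_mats :: nat \<Rightarrow> nat \<Rightarrow> 'a mat set)"
  have second: "int (\<Sum>A\<in>T r s. card (growth_layer A s)) = int (card (T r s)) * w r s" if "s < r" for r s
    using that card_growth_layer_second_row[where 'a = 'a]
    by (intro sum_card_eq_const) (auto simp: T_def w_def q_def)
  have first: "int (\<Sum>A\<in>T r s. card (growth_layer A r)) = int (card (T r s)) * (q ^ (r + s) - q ^ (r + s - 1))"
    if "s < r" for r s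
    using that card_growth_layer_first_row(2)[where 'a = 'a]
    by (intro sum_card_eq_const) (auto simp: T_def q_def)
  have first_diag: "int (\<Sum>A\<in>T s s. card (growth_layer A s)) = int (card (T s s)) * (q ^ (2 * s) - q ^ (2 * s - 2))"
    if "1 \<le> s" for s
    using that card_growth_layer_first_row(3)[where 'a = 'a]
    by (intro sum_card_eq_const) (auto simp: T_def q_def mult_2)
  note rec = card_two_row_mats[where 'a = 'a, folded T_def]
  have "int (card (T 1 0)) = int (\<Sum>A\<in>T 0 0. card (growth_layer A 0))"
    using rec[of 0 1] by simp
  also have "\<dots> = 1"
    using card_growth_layer_first_row(1)[where 'a = 'a] card_two_row_mats_0_0[where 'a = 'a]
    by (subst sum_card_eq_const[where c = 1]) (auto simp: T_def)
  finally have T_1_0: "int (card (T 1 0)) = 1" .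
  have T_0: "int (card (T (Suc (Suc r)) 0)) = int (card (T (Suc r) 0)) * (q ^ (r + 1) - q ^ r)" for r
    using rec[of 0 "Suc (Suc r)"] first[of 0 "Suc r"] by simp
  have T_diag: "int (card (T (Suc s) (Suc s))) = int (card (T (Suc s) s)) * w (Suc s) s" for s
    using rec[of "Suc s" "Suc s"] second[of s "Suc s"] by simp
  have T_first: "int (card (T (Suc s) s)) = int (card (T s s)) * (q ^ (2 * s) - q ^ (2 * s - 2)) +
      int (card (T (Suc s) (s - 1))) * w (Suc s) (s - 1)" if "1 \<le> s" for s
    using rec[of s "Suc s"] first_diag[of s] second[of "s - 1" "Suc s"] that by simp
  have T_step: "int (card (T (Suc r) s)) = int (card (T r s)) * (q ^ (r + s) - q ^ (r + s - 1)) +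
      int (card (T (Suc r) (s - 1))) * w (Suc r) (s - 1)" if "s < r" "1 \<le> s" for r s
    using rec[of s "Suc r"] first[of s r] second[of "s - 1" "Suc r"] that by simp
  have "q \<noteq> 0" by (simp add: q_def)
  note sol = two_row_recurrence_solution[of q "\<lambda>r s. int (card (T r s))" w,
      OF this T_1_0 T_0 T_diag T_first T_step, unfolded w_def T_def]
  show "1 \<le> s \<Longrightarrow> s < r \<Longrightarrow> int (card (two_row_mats r s :: 'a mat set)) * q ^ (2 * s) =
      (q - 1) ^ (r + s - 2) * q ^ (((r + s - 1) choose 2) + 1) * catalan_sum q r s"
    by (rule sol(1)) auto
  show "1 \<le> r \<Longrightarrow> int (card (two_row_mats r r :: 'a mat set)) =
      (q - 1) ^ (2 * r - 2) * q ^ ((2 * r - 2) choose 2) * catalan_sum q r (r - 1)"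
    by (rule sol(2)) auto
qed

lemma F_count_eq_card_two_row_mats:
  assumes "is_partition [r, s] n" "1 \<le> s" "s \<le> r"
  shows "F_count TYPE('a::{field,finite}) n [r, s] = card (two_row_mats r s :: 'a mat set)"
proof -
  have n: "n = r + s" using assms by (simp add: is_partition_def)
  have "{A :: 'a mat. A \<in> carrier_mat n n \<and> strictly_upper_triangular A \<and> has_jordan_type A [r, s]} =
      two_row_mats r s"
    unfolding two_row_mats_def n
    using has_jordan_type_iff_two_row_profile[OF _ _ assms(2,3), where 'a = 'a] by blast
  then show ?thesis by (simp add: F_count_def)
qed

theorem proposition2p14:
  fixes q :: int and n r s :: nat
  assumes q: "q = int CARD('a::{field,finite})"
  shows "(is_partition [r, s] n \<and> r > s \<and> s \<ge> 1 \<longrightarrow>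
           int (F_count TYPE('a) n [r, s]) =
             (q - 1) ^ (r + s - 2) * q ^ (((r + s - 1) choose 2) + 1 - 2 * s)
             * (\<Sum>i = 0..s. gen_catalan (r + s - i) i * q ^ i))
       \<and> (is_partition [r, r] n \<and> r \<ge> 1 \<longrightarrow>
           int (F_count TYPE('a) n [r, r]) =
             (q - 1) ^ (2 * r - 2) * q ^ ((2 * r - 2) choose 2)
             * (\<Sum>i = 0..r - 1. gen_catalan (2 * r - 1 - i) i * q ^ i))"
proof (intro conjI impI)
  have "q \<noteq> 0" by (simp add: q)
  assume h: "is_partition [r, s] n \<and> r > s \<and> s \<ge> 1"
  let ?b = "(r + s - 1) choose 2"
  obtain k where k: "r + s - 1 = Suc k" using h by (cases "r + s - 1") auto
  \<comment> \<open>The subtraction of 2s in the exponent is not truncated: the binomial plus 1 is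
    at least r + s - 1, and this is at least 2s because r > s.\<close>
  have "?b \<ge> k" unfolding k Suc_choose_two by simp
  then have exponent: "?b + 1 = (?b + 1 - 2 * s) + 2 * s" using h k by linarith
  have "int (card (two_row_mats r s :: 'a mat set)) * q ^ (2 * s) =
      (q - 1) ^ (r + s - 2) * q ^ (?b + 1) * catalan_sum q r s"
    using card_two_row_mats_closed_form(1)[where 'a = 'a, of s r] h by (simp add: q)
  also have "q ^ (?b + 1) = q ^ (?b + 1 - 2 * s) * q ^ (2 * s)"
    by (subst exponent) (rule power_add)
  finally have "int (card (two_row_mats r s :: 'a mat set)) =
      (q - 1) ^ (r + s - 2) * q ^ (?b + 1 - 2 * s) * catalan_sum q r s"
    using \<open>q \<noteq> 0\<close> by (simp add: ac_simps)
  then show "int (F_count TYPE('a) n [r, s]) =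
      (q - 1) ^ (r + s - 2) * q ^ (?b + 1 - 2 * s) * (\<Sum>i = 0..s. gen_catalan (r + s - i) i * q ^ i)"
    using F_count_eq_card_two_row_mats[where 'a = 'a, of r s n] h by (simp add: catalan_sum_def)
next
  assume h: "is_partition [r, r] n \<and> r \<ge> 1"
  then have "r + (r - 1) = 2 * r - 1" by simp
  then show "int (F_count TYPE('a) n [r, r]) =
      (q - 1) ^ (2 * r - 2) * q ^ ((2 * r - 2) choose 2) *
      (\<Sum>i = 0..r - 1. gen_catalan (2 * r - 1 - i) i * q ^ i)"
    using card_two_row_mats_closed_form(2)[where 'a = 'a, of r] h
      F_count_eq_card_two_row_mats[where 'a = 'a, of r r n]
    by (simp add: q catalan_sum_def)
qed

end
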